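(* Let $n\ge2$ and let $(G,H)\in\mathcal{H}_n\times\mathcal{H}_n$. Let $\mathbb{X}=\{\mathcal{X}^{(1)},\dots,\mathcal{X}^{(n-2)}\}$ be any complete tensor set of LSESC of order $n-1$, and let $\mathbf{X}^{(s)}_k$ denote the $k$-th frontal slice of $\mathcal{X}^{(s)}$. Let $G'$ be the matrix obtained from $G$ by deleting its first row, let $B_0=G'\otimes\mathbf{J}_{n-1}$, let $C$ be the core of $H$ with rows $\mathbf{c}_1,\dots,\mathbf{c}_{n-1}$, and let $$B=\left[\begin{array}{c|cccc} \mathbf{J}_{n-1}^{\top}\otimes\mathbf{c}_1&C&C&\cdots&C\\ \mathbf{J}_{n-1}^{\top}\otimes\mathbf{c}_2&\mathbf{X}^{(1)}_{1}C&\mathbf{X}^{(1)}_{2}C&\cdots&\mathbf{X}^{(1)}_{n-1}C\\ \mathbf{J}_{n-1}^{\top}\otimes\mathbf{c}_3&\mathbf{X}^{(2)}_{1}C&\mathbf{X}^{(2)}_{2}C&\cdots&\mathbf{X}^{(2)}_{n-1}C\\ \vdots&\vdots&\vdots&&\vdots\\ \mathbf{J}_{n-1}^{\top}\otimes\mathbf{c}_{n-1}&\mathbf{X}^{(n-2)}_{1}C&\mathbf{X}^{(n-2)}_{2}C&\cdots&\mathbf{X}^{(n-2)}_{n-1}C \end{array}\right].$$ Then $$\Phi_{\mathbb{X}}(G,H)=\left[\begin{array}{c}B_0\\ B\end{array}\right]$$ is a Hadamard matrix (of order $n(n-1)$).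
   Context: A Hadamard matrix of order $n$ is an $n\times n$ matrix $M$ with entries in $\{1,-1\}$ and $MM^{\top}=nI_n$. It is normalized if its first row and first column consist entirely of ones. $\mathcal{H}_n$ is the set of all normalized Hadamard matrices of order $n$. The core of a normalized matrix of order $n$ is the $(n-1)\times(n-1)$ matrix obtained by deleting its first row and first column. $\mathbf{J}_k$ is the $1\times k$ row vector of all ones. The Kronecker product of $X=(x_{ij})$ and $Y$ is the block matrix $X\otimes Y=(x_{ij}Y)$. A Latin square of order $k$ is a $k\times k$ matrix with entries in $\{1,\dots,k\}$ in which each symbol appears exactly once in each row and in each column. Two Latin squares $L=(l_{ij})$ and $L'=(l'_{ij})$ of order $k$ are said to be LSESC (Latin squares eligible for Scarpis construction) if for all $i,i'\in\{1,\dots,k\}$ there is a unique $j\in\{1,\dots,k\}$ with $l_{ij}=l'_{i'j}$. A complete set of LSESC of order $k$ is a set $\{L^{(1)},\dots,L^{(k-1)}\}$ of $k-1$ Latin squares of order $k$ such that any two distinct members are LSESC. To a Latin square $L$ of order $k$ associate the cubic tensor $F(L)$ of dimensions $k\times k\times k$ whose frontal slices are the $k\times k$ permutation matrices $\mathbf{X}_1,\dots,\mathbf{X}_k$, where the $(i,j)$ entry of $\mathbf{X}_t$ is $1$ if $l_{it}=j$ and $0$ otherwise. A complete tensor set of LSESC of order $k$ is $\{F(L^{(1)}),\dots,F(L^{(k-1)})\}$ for a complete set of LSESC $\{L^{(1)},\dots,L^{(k-1)}\}$ of order $k$. *)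

theory Defs
  imports "Jordan_Normal_Form.Determinant"
begin

(* Matrix positions are 0-based, as in the matrix library; the symbols of a Latin square of
   order k are 1, ..., k. *)

definition hadamard_matrix :: "nat \<Rightarrow> int mat \<Rightarrow> bool" where
  "hadamard_matrix n M \<longleftrightarrow>
     M \<in> carrier_mat n n \<and>
     (\<forall>i<n. \<forall>j<n. M $$ (i, j) \<in> {1, -1}) \<and>
     M * M\<^sup>T = int n \<cdot>\<^sub>m 1\<^sub>m n"

definition normalized_hadamard :: "nat \<Rightarrow> int mat set" where
  "normalized_hadamard n =
     {M. hadamard_matrix n M \<and> (\<forall>j<n. M $$ (0, j) = 1) \<and> (\<forall>i<n. M $$ (i, 0) = 1)}"

definition core :: "int mat \<Rightarrow> int mat" where
  "core M = mat_delete M 0 0"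

definition delete_first_row :: "'a mat \<Rightarrow> 'a mat" where
  "delete_first_row M = mat (dim_row M - 1) (dim_col M) (\<lambda>(i, j). M $$ (Suc i, j))"

(* The p by q block matrix whose (s, t) block is the r by c matrix A s t. *)
definition block_matrix ::
    "nat \<Rightarrow> nat \<Rightarrow> nat \<Rightarrow> nat \<Rightarrow> (nat \<Rightarrow> nat \<Rightarrow> 'a mat) \<Rightarrow> 'a mat" where
  "block_matrix p q r c A =
     mat (p * r) (q * c) (\<lambda>(i, j). A (i div r) (j div c) $$ (i mod r, j mod c))"

definition kronecker_product :: "'a::times mat \<Rightarrow> 'a mat \<Rightarrow> 'a mat" (infixl "\<otimes>\<^sub>K" 70) where
  "X \<otimes>\<^sub>K Y =
     block_matrix (dim_row X) (dim_col X) (dim_row Y) (dim_col Y) (\<lambda>i j. X $$ (i, j) \<cdot>\<^sub>m Y)"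

definition ones_row :: "nat \<Rightarrow> int mat" where
  "ones_row k = mat 1 k (\<lambda>_. 1)"

definition row_matrix :: "'a mat \<Rightarrow> nat \<Rightarrow> 'a mat" where
  "row_matrix M i = mat_of_rows (dim_col M) [row M i]"

definition latin_square :: "nat \<Rightarrow> nat mat \<Rightarrow> bool" where
  "latin_square k L \<longleftrightarrow>
     L \<in> carrier_mat k k \<and>
     (\<forall>i<k. \<forall>j<k. L $$ (i, j) \<in> {1..k}) \<and>
     (\<forall>i<k. \<forall>a\<in>{1..k}. \<exists>!j. j < k \<and> L $$ (i, j) = a) \<and>
     (\<forall>j<k. \<forall>a\<in>{1..k}. \<exists>!i. i < k \<and> L $$ (i, j) = a)"

definition LSESC :: "nat \<Rightarrow> nat mat \<Rightarrow> nat mat \<Rightarrow> bool" where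
  "LSESC k L L' \<longleftrightarrow>
     latin_square k L \<and> latin_square k L' \<and>
     (\<forall>i<k. \<forall>i'<k. \<exists>!j. j < k \<and> L $$ (i, j) = L' $$ (i', j))"

definition complete_LSESC :: "nat \<Rightarrow> nat mat set \<Rightarrow> bool" where
  "complete_LSESC k S \<longleftrightarrow>
     finite S \<and> card S = k - 1 \<and>
     (\<forall>L\<in>S. latin_square k L) \<and>
     (\<forall>L\<in>S. \<forall>L'\<in>S. L \<noteq> L' \<longrightarrow> LSESC k L L')"

(* A third-order tensor is given by the list of its frontal slices. *)
type_synonym tensor = "int mat list"

(* The slices are numbered from 1. *)
definition frontal_slice :: "tensor \<Rightarrow> nat \<Rightarrow> int mat" where
  "frontal_slice T k = T ! (k - 1)"

(* The column position j stands for the symbol j + 1. *)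
definition latin_tensor :: "nat \<Rightarrow> nat mat \<Rightarrow> tensor" where
  "latin_tensor k L =
     map (\<lambda>t. mat k k (\<lambda>(i, j). if L $$ (i, t) = Suc j then 1 else 0)) [0..<k]"

definition complete_tensor_set :: "nat \<Rightarrow> tensor set \<Rightarrow> bool" where
  "complete_tensor_set k \<X> \<longleftrightarrow> (\<exists>S. complete_LSESC k S \<and> \<X> = latin_tensor k ` S)"

definition scarpis_top :: "nat \<Rightarrow> int mat \<Rightarrow> int mat" where
  "scarpis_top n G = delete_first_row G \<otimes>\<^sub>K ones_row (n - 1)"

(* Block row s (counted from 0) starts with the block built from the core row at position s.
   For s, t > 0 the block is the t-th frontal slice of X s times the core. *)
definition scarpis_bottom :: "nat \<Rightarrow> (nat \<Rightarrow> tensor) \<Rightarrow> int mat \<Rightarrow> int mat" where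
  "scarpis_bottom n X H =
     block_matrix (n - 1) n (n - 1) (n - 1)
       (\<lambda>s t. if t = 0 then (ones_row (n - 1))\<^sup>T \<otimes>\<^sub>K row_matrix (core H) s
              else if s = 0 then core H
              else frontal_slice (X s) t * core H)"

definition scarpis_matrix ::
    "nat \<Rightarrow> (nat \<Rightarrow> tensor) \<Rightarrow> int mat \<Rightarrow> int mat \<Rightarrow> int mat" where
  "scarpis_matrix n X G H = scarpis_top n G @\<^sub>r scarpis_bottom n X H"

end

theory Submission
  imports Defs
begin

text \<open>
  Every row of the lower part is a sequence of \<open>n\<close> rows of the core \<open>C\<close>, so it is encoded by a word
  of length \<open>n\<close> over the row indices of \<open>C\<close>. The Latin square conditions say precisely that two
  distinct words agree in exactly one position. As distinct rows of \<open>C\<close> have inner product \<open>-1\<close> and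
  each row has squared norm \<open>n - 1\<close>, the inner product of two lower rows is \<open>n\<close> times the number of
  agreements minus \<open>n\<close>, which vanishes for distinct words. The upper rows are orthogonal to the
  lower ones because every row of \<open>C\<close> sums to \<open>-1\<close> and every row of \<open>G\<close> but the first sums to \<open>0\<close>.
\<close>

section \<open>Block sums, and Hadamard matrices through inner products of rows\<close>

text \<open>The range splits into \<open>n\<close> consecutive intervals of length \<open>k\<close>;
  on interval \<open>t\<close> the quotient is \<open>t\<close> and the remainder runs through all
  values below \<open>k\<close>. This lets inner products of long rows be computed block by
  block.\<close>

lemma sum_div_mod:
  fixes f :: "nat \<Rightarrow> nat \<Rightarrow> 'a::comm_monoid_add"
  shows "(\<Sum>b<n * k. f (b div k) (b mod k)) = (\<Sum>t<n. \<Sum>j<k. f t j)"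
proof -
  have "(\<Sum>b = t * k..<t * k + k. f (b div k) (b mod k)) = (\<Sum>j<k. f t j)" for t
    by (rule sum.reindex_bij_witness[of _ "\<lambda>j. t * k + j" "\<lambda>b. b - t * k"])
       (auto simp: div_nat_eqI mod_nat_eqI add.commute mult.commute,
        (metis add.commute div_mult_self1 div_less add_0_right le_add_diff_inverse less_diff_conv2
           mult.commute less_nat_zero_code mod_less mod_mult_self1)+)
  then show ?thesis
    by (simp add: sum.nat_group[symmetric])
qed

lemma index_mult_transpose:
  fixes M :: "'a::comm_semiring_0 mat"
  assumes "M \<in> carrier_mat m n" "a < m" "b < m"
  shows "(M * M\<^sup>T) $$ (a, b) = (\<Sum>l<n. M $$ (a, l) * M $$ (b, l))"
  using assms by (auto simp: scalar_prod_def atLeast0LessThan intro!: sum.cong)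

text \<open>Entry \<open>(a, b)\<close> of \<open>M * M\<^sup>T\<close> is the inner product of rows
  \<open>a\<close> and \<open>b\<close>.\<close>

lemma hadamard_matrix_iff:
  "hadamard_matrix n M \<longleftrightarrow>
     M \<in> carrier_mat n n \<and> (\<forall>i<n. \<forall>j<n. M $$ (i, j) \<in> {1, -1}) \<and>
     (\<forall>a<n. \<forall>b<n. (\<Sum>l<n. M $$ (a, l) * M $$ (b, l)) = (if a = b then int n else 0))"
proof -
  have "M * M\<^sup>T = int n \<cdot>\<^sub>m 1\<^sub>m n \<longleftrightarrow>
      (\<forall>a<n. \<forall>b<n. (\<Sum>l<n. M $$ (a, l) * M $$ (b, l)) = (if a = b then int n else 0))"
    if M: "M \<in> carrier_mat n n"
  proof -
    have "M * M\<^sup>T = int n \<cdot>\<^sub>m 1\<^sub>m n \<longleftrightarrow>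
        (\<forall>a<n. \<forall>b<n. (M * M\<^sup>T) $$ (a, b) = (if a = b then int n else 0))"
      using M by (auto simp: mat_eq_iff simp del: index_mult_mat(1))
    also have "\<dots> \<longleftrightarrow>
      (\<forall>a<n. \<forall>b<n. (\<Sum>l<n. M $$ (a, l) * M $$ (b, l)) = (if a = b then int n else 0))"
      using index_mult_transpose[OF M] by simp
    finally show ?thesis .
  qed
  then show ?thesis
    unfolding hadamard_matrix_def by blast
qed

section \<open>Row sums and inner products in the core\<close>

text \<open>Orthogonality to row 0, which consists of ones.\<close>

lemma normalized_hadamard_row_sum:
  assumes "M \<in> normalized_hadamard n" "0 < a" "a < n"
  shows "(\<Sum>l<n. M $$ (a, l)) = 0"
proof -
  have "(\<Sum>l<n. M $$ (a, l) * M $$ (0, l)) = 0"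
    using assms by (auto simp: normalized_hadamard_def hadamard_matrix_iff)
  moreover have "(\<Sum>l<n. M $$ (a, l) * M $$ (0, l)) = (\<Sum>l<n. M $$ (a, l))"
    using assms by (auto simp: normalized_hadamard_def)
  ultimately show ?thesis by simp
qed

lemma core_index:
  assumes "H \<in> carrier_mat (Suc k) (Suc k)" "x < k" "j < k"
  shows "core H $$ (x, j) = H $$ (Suc x, Suc j)"
  using assms by (simp add: core_def mat_delete_def)

lemma core_carrier: "H \<in> carrier_mat (Suc k) (Suc k) \<Longrightarrow> core H \<in> carrier_mat k k"
  by (auto simp: core_def mat_delete_def)

text \<open>The corresponding row of \<open>H\<close> sums to 0, and the core drops its leading
  1.\<close>

lemma core_row_sum:
  assumes H: "H \<in> normalized_hadamard (Suc k)" and x: "x < k"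
  shows "(\<Sum>j<k. core H $$ (x, j)) = -1"
proof -
  have "H \<in> carrier_mat (Suc k) (Suc k)" "H $$ (Suc x, 0) = 1"
    using H x by (auto simp: normalized_hadamard_def hadamard_matrix_def)
  then show ?thesis
    using normalized_hadamard_row_sum[OF H, of "Suc x"] x
    by (simp add: core_index sum.lessThan_Suc_shift del: sum.lessThan_Suc)
qed

text \<open>Dropping the first column removes the product 1 of the two leading entries from an inner
  product of rows of \<open>H\<close>.\<close>

lemma core_row_product:
  assumes H: "H \<in> normalized_hadamard (Suc k)" and x: "x < k" and y: "y < k"
  shows "(\<Sum>j<k. core H $$ (x, j) * core H $$ (y, j)) = int (Suc k) * of_bool (x = y) - 1"
proof -
  have "H \<in> carrier_mat (Suc k) (Suc k)" "H $$ (Suc x, 0) = 1" "H $$ (Suc y, 0) = 1"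
    using H x y by (auto simp: normalized_hadamard_def hadamard_matrix_def)
  moreover have "(\<Sum>l<Suc k. H $$ (Suc x, l) * H $$ (Suc y, l)) = int (Suc k) * of_bool (x = y)"
    using H x y by (auto simp: normalized_hadamard_def hadamard_matrix_iff simp del: sum.lessThan_Suc)
  ultimately show ?thesis
    using x y by (simp add: core_index sum.lessThan_Suc_shift del: sum.lessThan_Suc)
qed

lemma core_entry:
  assumes "H \<in> normalized_hadamard (Suc k)" "x < k" "j < k"
  shows "core H $$ (x, j) \<in> {1, -1}"
proof -
  have "H \<in> carrier_mat (Suc k) (Suc k)" "H $$ (Suc x, Suc j) \<in> {1, -1}"
    using assms unfolding normalized_hadamard_def hadamard_matrix_def by blast+
  then show ?thesis
    using assms by (simp add: core_index)
qed

section \<open>Latin squares and their permutation slices\<close>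

lemma latin_square_range:
  assumes "latin_square k L" "i < k" "j < k"
  shows "1 \<le> L $$ (i, j)" "L $$ (i, j) \<le> k"
  using assms by (auto simp: latin_square_def)

lemma latin_square_row:
  assumes "latin_square k L" "i < k" "a \<in> {1..k}"
  shows "\<exists>!j. j < k \<and> L $$ (i, j) = a"
  using assms by (simp add: latin_square_def)

lemma latin_square_column_inj:
  assumes L: "latin_square k L" and "i < k" "i' < k" "j < k" "L $$ (i, j) = L $$ (i', j)"
  shows "i = i'"
proof -
  have "L $$ (i, j) \<in> {1..k}"
    using L assms by (auto dest: latin_square_range)
  then have "\<exists>!r. r < k \<and> L $$ (r, j) = L $$ (i, j)"
    using L \<open>j < k\<close> by (simp add: latin_square_def)
  then show ?thesis
    using assms by metis
qed

text \<open>Row \<open>i\<close> of the slice has its only 1 in the column of the symbol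
  \<open>L $$ (i, t - 1)\<close>, so the product picks that row of \<open>C\<close>. Slices and
  symbols count from 1, matrix positions from 0, hence both subtractions.\<close>

lemma latin_slice_mult:
  assumes L: "latin_square k L" and C: "C \<in> carrier_mat k k"
    and "0 < t" "t \<le> k" "i < k" "j < k"
  shows "(frontal_slice (latin_tensor k L) t * C) $$ (i, j) = C $$ (L $$ (i, t - 1) - 1, j)"
proof -
  have r: "1 \<le> L $$ (i, t - 1)" "L $$ (i, t - 1) \<le> k"
    using latin_square_range[OF L, of i "t - 1"] assms by auto
  have "[0..<k] ! (t - 1) = t - 1"
    using assms by (subst nth_upt) auto
  then have "frontal_slice (latin_tensor k L) t =
      mat k k (\<lambda>(i, j). if L $$ (i, t - 1) = Suc j then 1 else 0)"
    using assms by (simp add: frontal_slice_def latin_tensor_def)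
  then have "(frontal_slice (latin_tensor k L) t * C) $$ (i, j) =
      (\<Sum>l<k. (if L $$ (i, t - 1) = Suc l then 1 else 0) * C $$ (l, j))"
    using assms by (auto simp: scalar_prod_def atLeast0LessThan intro!: sum.cong)
  also have "\<dots> = (\<Sum>l<k. if l = L $$ (i, t - 1) - 1 then C $$ (l, j) else 0)"
    using r by (intro sum.cong) auto
  also have "\<dots> = C $$ (L $$ (i, t - 1) - 1, j)"
    using r by (subst sum.delta) auto
  finally show ?thesis .
qed

section \<open>Words of core rows and their agreements\<close>

text \<open>The row of the core found in block column \<open>t\<close> of row \<open>i\<close> of block row \<open>s\<close>.\<close>

definition scarpis_word :: "(nat \<Rightarrow> nat mat) \<Rightarrow> nat \<Rightarrow> nat \<Rightarrow> nat \<Rightarrow> nat" where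
  "scarpis_word L s i t = (if t = 0 then s else if s = 0 then i else L s $$ (i, t - 1) - 1)"

lemma scarpis_word_less:
  assumes "\<forall>s\<in>{1..<k}. latin_square k (L s)" "s < k" "i < k" "t \<le> k"
  shows "scarpis_word L s i t < k"
proof (cases "s = 0 \<or> t = 0")
  case True
  then show ?thesis using assms by (auto simp: scarpis_word_def)
next
  case False
  then have "1 \<le> L s $$ (i, t - 1)" "L s $$ (i, t - 1) \<le> k"
    using assms latin_square_range[of k "L s" i "t - 1"] by auto
  then show ?thesis using False assms(3) by (simp add: scarpis_word_def)
qed

text \<open>Within one block row only position 0 agrees, since Latin columns have no repetition.
  Across block rows position 0 fails; the single agreement comes from a Latin row if one of them is
  block row 0, and from the LSESC condition otherwise.\<close>

lemma scarpis_word_agreements: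
  assumes latin: "\<forall>s\<in>{1..<k}. latin_square k (L s)"
    and lsesc: "\<forall>s\<in>{1..<k}. \<forall>s'\<in>{1..<k}. s \<noteq> s' \<longrightarrow> LSESC k (L s) (L s')"
    and s: "s < k" "s' < k" and i: "i < k" "i' < k"
    and neq: "(s, i) \<noteq> (s', i')"
  shows "card {t. t < Suc k \<and> scarpis_word L s i t = scarpis_word L s' i' t} = 1"
proof -
  have "\<exists>!t. t < Suc k \<and> scarpis_word L s i t = scarpis_word L s' i' t"
  proof (cases "s = s'")
    case True
    then have "i \<noteq> i'" using neq by simp
    have "t = 0" if "t < Suc k" "scarpis_word L s i t = scarpis_word L s' i' t" for t
    proof (rule ccontr)
      assume t: "t \<noteq> 0"
      \<comment> \<open>Past position 0 the words of block row 0 are constantly \<open>i\<close> and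
        \<open>i'\<close>, which differ.\<close>
      have "s \<noteq> 0"
        using that(2) t True \<open>i \<noteq> i'\<close> by (auto simp: scarpis_word_def split: if_splits)
      then have L: "latin_square k (L s)"
        using latin s by simp
      have tk: "t - 1 < k"
        using that(1) t by simp
      \<comment> \<open>Symbols are at least 1, so truncated subtraction of 1 is injective on
        them.\<close>
      have "L s $$ (i, t - 1) = L s $$ (i', t - 1)"
        using that(2) t True \<open>s \<noteq> 0\<close> latin_square_range(1)[OF L i(1) tk]
          latin_square_range(1)[OF L i(2) tk]
        by (simp add: scarpis_word_def)
      then show False
        using latin_square_column_inj[OF L i tk] \<open>i \<noteq> i'\<close> by auto
    qed
    moreover have "scarpis_word L s i 0 = scarpis_word L s' i' 0"
      using True by (simp add: scarpis_word_def)
    ultimately show ?thesis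
      by (intro ex1I[of _ 0]) auto
  next
    case False
    \<comment> \<open>Position 0 carries the distinct letters \<open>s\<close> and
      \<open>s'\<close>; position \<open>Suc j\<close> corresponds to column \<open>j\<close> of the
      Latin squares.\<close>
    have "\<exists>!j. j < k \<and> scarpis_word L s i (Suc j) = scarpis_word L s' i' (Suc j)"
    proof -
      consider "s = 0" "s' \<noteq> 0" | "s \<noteq> 0" "s' = 0" | "s \<noteq> 0" "s' \<noteq> 0"
        using False by auto
      then show ?thesis
      proof cases
        case 1
        then have L: "latin_square k (L s')" using latin s by simp
        \<comment> \<open>The word of block row 0 is constantly \<open>i\<close> here, and the
          symbol \<open>Suc i\<close> stands once in row \<open>i'\<close> of
          \<open>L s'\<close>.\<close>
        have "i = L s' $$ (i', j) - 1 \<longleftrightarrow> L s' $$ (i', j) = Suc i" if "j < k" for j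
          using latin_square_range(1)[OF L i(2) that] by auto
        then show ?thesis
          using latin_square_row[OF L i(2), of "Suc i"] i 1
          by (simp add: scarpis_word_def cong: conj_cong)
      next
        case 2
        then have L: "latin_square k (L s)" using latin s by simp
        have "L s $$ (i, j) - 1 = i' \<longleftrightarrow> L s $$ (i, j) = Suc i'" if "j < k" for j
          using latin_square_range(1)[OF L i(1) that] by auto
        then show ?thesis
          using latin_square_row[OF L i(1), of "Suc i'"] i 2
          by (simp add: scarpis_word_def cong: conj_cong)
      next
        case 3
        then have L: "latin_square k (L s)" "latin_square k (L s')" using latin s by simp_all
        have "L s $$ (i, j) - 1 = L s' $$ (i', j) - 1 \<longleftrightarrow> L s $$ (i, j) = L s' $$ (i', j)"
          if "j < k" for j
          using latin_square_range(1)[OF L(1) i(1) that] latin_square_range(1)[OF L(2) i(2) that]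
          by auto
        then show ?thesis
          using lsesc False 3 s i
          by (simp add: scarpis_word_def LSESC_def cong: conj_cong)
      qed
    qed
    then obtain j where j: "j < k" "scarpis_word L s i (Suc j) = scarpis_word L s' i' (Suc j)"
      and uniq: "\<And>j'. j' < k \<Longrightarrow>
        scarpis_word L s i (Suc j') = scarpis_word L s' i' (Suc j') \<Longrightarrow> j' = j"
      by blast
    have "t = Suc j" if "t < Suc k" "scarpis_word L s i t = scarpis_word L s' i' t" for t
      using that uniq False by (cases t) (auto simp: scarpis_word_def)
    then show ?thesis
      using j by (intro ex1I[of _ "Suc j"]) auto
  qed
  then obtain t where "{t. t < Suc k \<and> scarpis_word L s i t = scarpis_word L s' i' t} = {t}"
    by blast
  then show ?thesis
    by simp
qed

lemma scarpis_word_product: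
  assumes H: "H \<in> normalized_hadamard (Suc k)"
    and latin: "\<forall>s\<in>{1..<k}. latin_square k (L s)"
    and lsesc: "\<forall>s\<in>{1..<k}. \<forall>s'\<in>{1..<k}. s \<noteq> s' \<longrightarrow> LSESC k (L s) (L s')"
    and s: "s < k" "s' < k" and i: "i < k" "i' < k"
  shows "(\<Sum>t<Suc k. \<Sum>j<k.
            core H $$ (scarpis_word L s i t, j) * core H $$ (scarpis_word L s' i' t, j)) =
          (if (s, i) = (s', i') then int (Suc k * k) else 0)"
proof -
  let ?A = "{t. t < Suc k \<and> scarpis_word L s i t = scarpis_word L s' i' t}"
  have "(\<Sum>t<Suc k. \<Sum>j<k.
            core H $$ (scarpis_word L s i t, j) * core H $$ (scarpis_word L s' i' t, j)) =
        (\<Sum>t<Suc k. int (Suc k) * of_bool (scarpis_word L s i t = scarpis_word L s' i' t) - 1)"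
    using s i by (intro sum.cong core_row_product[OF H] scarpis_word_less[OF latin]) auto
  also have "\<dots> = int (Suc k) * int (card ?A) - int (Suc k)"
    by (simp add: sum_subtractf sum_distrib_left[symmetric] sum.If_cases of_bool_def
        Int_def del: sum.lessThan_Suc)
  also have "\<dots> = (if (s, i) = (s', i') then int (Suc k * k) else 0)"
  proof (cases "(s, i) = (s', i')")
    case True
    \<comment> \<open>Equal words agree in all \<open>Suc k\<close> positions, which gives
      \<open>Suc k * Suc k - Suc k = Suc k * k\<close>.\<close>
    then show ?thesis by (simp add: algebra_simps)
  next
    case False
    have "card ?A = 1"
      by (rule scarpis_word_agreements[OF latin lsesc s i False])
    then show ?thesis
      using False by auto
  qed
  finally show ?thesis .
qed

section \<open>Dimensions and entries of the Scarpis matrix\<close>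

lemma scarpis_top_carrier:
  assumes "G \<in> carrier_mat (Suc k) (Suc k)"
  shows "scarpis_top (Suc k) G \<in> carrier_mat k (Suc k * k)"
  using assms
  by (simp add: scarpis_top_def kronecker_product_def block_matrix_def delete_first_row_def
      ones_row_def)

lemma scarpis_bottom_carrier: "scarpis_bottom (Suc k) X H \<in> carrier_mat (k * k) (Suc k * k)"
  by (simp add: scarpis_bottom_def block_matrix_def)

lemma scarpis_matrix_carrier:
  assumes "G \<in> carrier_mat (Suc k) (Suc k)"
  shows "scarpis_matrix (Suc k) X G H \<in> carrier_mat (Suc k * k) (Suc k * k)"
  using carrier_append_rows[OF scarpis_top_carrier[OF assms] scarpis_bottom_carrier]
  by (simp add: scarpis_matrix_def)

text \<open>The Kronecker product with a row of ones repeats each entry of \<open>G\<close> in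
  \<open>k\<close> consecutive columns; \<open>Suc a\<close> accounts for the deleted first
  row.\<close>

lemma scarpis_matrix_upper:
  assumes G: "G \<in> carrier_mat (Suc k) (Suc k)" and a: "a < k" and b: "b < Suc k * k"
  shows "scarpis_matrix (Suc k) X G H $$ (a, b) = G $$ (Suc a, b div k)"
proof -
  have "b div k < Suc k" "b mod k < k"
    using a b by (auto simp: less_mult_imp_div_less)
  then have "scarpis_top (Suc k) G $$ (a, b) = G $$ (Suc a, b div k)"
    using G a b
    by (simp add: scarpis_top_def kronecker_product_def block_matrix_def delete_first_row_def
        ones_row_def)
  then show ?thesis
    using a b scarpis_top_carrier[OF G] scarpis_bottom_carrier[of k X H]
    by (simp add: scarpis_matrix_def append_rows_def)
qed

text \<open>The upper part fills the first \<open>k\<close> rows, so \<open>a - k\<close> counts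
  rows of the lower part; dividing by \<open>k\<close> gives the block row and the row inside
  it.\<close>

lemma scarpis_matrix_lower:
  assumes G: "G \<in> carrier_mat (Suc k) (Suc k)" and H: "H \<in> carrier_mat (Suc k) (Suc k)"
    and latin: "\<forall>s\<in>{1..<k}. latin_square k (L s)"
    and X: "\<forall>s\<in>{1..<k}. X s = latin_tensor k (L s)"
    and a: "k \<le> a" "a < Suc k * k" and b: "b < Suc k * k"
  shows "scarpis_matrix (Suc k) X G H $$ (a, b) =
    core H $$ (scarpis_word L ((a - k) div k) ((a - k) mod k) (b div k), b mod k)"
proof -
  define s i where "s = (a - k) div k" and "i = (a - k) mod k"
  have C: "core H \<in> carrier_mat k k"
    using H by (rule core_carrier)
  have ak: "a - k < k * k" and k: "0 < k"
    using a by (auto intro: Nat.gr0I)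
  then have lt: "b div k < Suc k" "b mod k < k" "s < k" "i < k"
    using b by (auto simp: s_def i_def less_mult_imp_div_less)
  have "scarpis_bottom (Suc k) X H $$ (a - k, b) =
      core H $$ (scarpis_word L s i (b div k), b mod k)"
  \<comment> \<open>The first block column repeats core row \<open>s\<close> and block row 0 copies
    the core; only the remaining blocks involve a slice.\<close>
  proof (cases "b div k = 0 \<or> s = 0")
    case True
    then show ?thesis
      using ak b lt C
      by (auto simp: scarpis_bottom_def block_matrix_def scarpis_word_def kronecker_product_def
          ones_row_def row_matrix_def mat_of_rows_def simp flip: s_def i_def)
  next
    case False
    then show ?thesis
      using ak b lt C bspec[OF X, of s] latin_slice_mult[OF _ C, of "L s" "b div k" i "b mod k"] latin
      by (simp add: scarpis_bottom_def block_matrix_def scarpis_word_def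
          del: index_mult_mat flip: s_def i_def)
  qed
  then show ?thesis
    using a b scarpis_top_carrier[OF G] scarpis_bottom_carrier[of k X H]
    by (simp add: scarpis_matrix_def append_rows_def s_def i_def)
qed

section \<open>Orthogonality of all pairs of rows\<close>

text \<open>Two upper rows reduce to orthogonality in \<open>G\<close>, a mixed pair to row sums,
  and two lower rows to counting agreements of words.\<close>

lemma hadamard_scarpis_matrix:
  assumes G: "G \<in> normalized_hadamard (Suc k)" and H: "H \<in> normalized_hadamard (Suc k)"
    and latin: "\<forall>s\<in>{1..<k}. latin_square k (L s)"
    and lsesc: "\<forall>s\<in>{1..<k}. \<forall>s'\<in>{1..<k}. s \<noteq> s' \<longrightarrow> LSESC k (L s) (L s')"
    and X: "\<forall>s\<in>{1..<k}. X s = latin_tensor k (L s)"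
  shows "hadamard_matrix (Suc k * k) (scarpis_matrix (Suc k) X G H)"
proof -
  define N where "N = Suc k * k"
  define M where "M = scarpis_matrix (Suc k) X G H"
  define w where "w a = scarpis_word L ((a - k) div k) ((a - k) mod k)" for a
  have Gc: "G \<in> carrier_mat (Suc k) (Suc k)" and Hc: "H \<in> carrier_mat (Suc k) (Suc k)"
    using G H by (auto simp: normalized_hadamard_def hadamard_matrix_def)
  have up: "M $$ (a, b) = G $$ (Suc a, b div k)" if "a < k" "b < N" for a b
    using scarpis_matrix_upper[OF Gc, of a b] that by (simp add: M_def N_def)
  have low: "M $$ (a, b) = core H $$ (w a (b div k), b mod k)" if "k \<le> a" "a < N" "b < N" for a b
    using scarpis_matrix_lower[OF Gc Hc latin X, of a b] that by (simp add: M_def N_def w_def)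
  have index: "(a - k) div k < k" "(a - k) mod k < k" if "k \<le> a" "a < N" for a
  proof -
    have "a - k < k * k" "0 < k"
      using that by (auto simp: N_def intro: gr0I)
    then show "(a - k) div k < k" "(a - k) mod k < k"
      by (auto simp: less_mult_imp_div_less)
  qed
  have w_less: "w a t < k" if "k \<le> a" "a < N" "t < Suc k" for a t
    unfolding w_def using scarpis_word_less[OF latin index[OF that(1,2)]] that(3) by simp
  have block: "b div k < Suc k" "b mod k < k" if "b < N" for b
  proof -
    have "0 < k"
      using that by (auto simp: N_def intro: gr0I)
    then show "b div k < Suc k" "b mod k < k"
      using that by (auto simp: N_def less_mult_imp_div_less)
  qed
  have mixed: "(\<Sum>l<N. M $$ (a, l) * M $$ (b, l)) = 0" if ab: "a < k" "k \<le> b" "b < N" for a b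
  proof -
    have "(\<Sum>l<N. M $$ (a, l) * M $$ (b, l)) =
        (\<Sum>l<Suc k * k. G $$ (Suc a, l div k) * core H $$ (w b (l div k), l mod k))"
      using ab by (intro sum.cong) (auto simp: up low N_def)
    also have "\<dots> = (\<Sum>t<Suc k. \<Sum>j<k. G $$ (Suc a, t) * core H $$ (w b t, j))"
      by (rule sum_div_mod)
    \<comment> \<open>Inside block \<open>t\<close> the factor from \<open>G\<close> is constant,
      leaving a core row sum.\<close>
    also have "\<dots> = (\<Sum>t<Suc k. G $$ (Suc a, t) * (-1))"
      by (intro sum.cong) (auto simp: sum_distrib_left[symmetric] core_row_sum[OF H] w_less ab)
    also have "\<dots> = 0"
      using normalized_hadamard_row_sum[OF G, of "Suc a"] ab
      by (simp add: sum_negf del: sum.lessThan_Suc)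
    finally show ?thesis .
  qed
  have upper: "(\<Sum>l<N. M $$ (a, l) * M $$ (b, l)) = (if a = b then int N else 0)"
    if ab: "a < k" "b < k" for a b
  proof -
    have "(\<Sum>l<N. M $$ (a, l) * M $$ (b, l)) =
        (\<Sum>l<Suc k * k. G $$ (Suc a, l div k) * G $$ (Suc b, l div k))"
      using ab by (intro sum.cong) (auto simp: up N_def)
    also have "\<dots> = (\<Sum>t<Suc k. \<Sum>j<k. G $$ (Suc a, t) * G $$ (Suc b, t))"
      by (rule sum_div_mod)
    also have "\<dots> = int k * (\<Sum>t<Suc k. G $$ (Suc a, t) * G $$ (Suc b, t))"
      by (simp add: sum_distrib_left del: sum.lessThan_Suc)
    also have "\<dots> = (if a = b then int N else 0)"
      using G ab
      by (auto simp: normalized_hadamard_def hadamard_matrix_iff N_def algebra_simps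
          simp del: sum.lessThan_Suc)
    finally show ?thesis .
  qed
  have lower: "(\<Sum>l<N. M $$ (a, l) * M $$ (b, l)) = (if a = b then int N else 0)"
    if ab: "k \<le> a" "a < N" "k \<le> b" "b < N" for a b
  proof -
    have "(\<Sum>l<N. M $$ (a, l) * M $$ (b, l)) =
        (\<Sum>l<Suc k * k. core H $$ (w a (l div k), l mod k) * core H $$ (w b (l div k), l mod k))"
      using ab by (intro sum.cong) (auto simp: low N_def)
    also have "\<dots> = (\<Sum>t<Suc k. \<Sum>j<k. core H $$ (w a t, j) * core H $$ (w b t, j))"
      by (rule sum_div_mod)
    also have "\<dots> = (if ((a - k) div k, (a - k) mod k) = ((b - k) div k, (b - k) mod k)
        then int N else 0)"
      unfolding w_def N_def
      using ab by (intro scarpis_word_product[OF H latin lsesc] index)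
    \<comment> \<open>Quotient and remainder determine \<open>a - k\<close>; as both rows lie at or
      beyond \<open>k\<close>, truncated subtraction then loses nothing.\<close>
    also have "((a - k) div k, (a - k) mod k) = ((b - k) div k, (b - k) mod k) \<longleftrightarrow> a - k = b - k"
      by (metis Pair_inject div_mult_mod_eq)
    also have "a - k = b - k \<longleftrightarrow> a = b"
      using ab by (simp add: eq_diff_iff)
    finally show ?thesis .
  qed
  have "M $$ (a, b) \<in> {1, -1}" if "a < N" "b < N" for a b
  proof (cases "a < k")
    case True
    then show ?thesis
      using G block[OF that(2)]
      by (simp add: up that normalized_hadamard_def hadamard_matrix_def)
  next
    case False
    then show ?thesis
      using core_entry[OF H w_less block(2)[OF that(2)]] block(1)[OF that(2)] that
      by (simp add: low)
  qed
  moreover have "(\<Sum>l<N. M $$ (a, l) * M $$ (b, l)) = (if a = b then int N else 0)"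
    if "a < N" "b < N" for a b
  proof -
    consider "a < k" "b < k" | "a < k" "k \<le> b" | "k \<le> a" "b < k" | "k \<le> a" "k \<le> b"
      by linarith
    then show ?thesis
      using that upper[of a b] mixed[of a b] mixed[of b a] lower[of a b]
      by cases (auto simp: mult.commute)
  qed
  moreover have "M \<in> carrier_mat N N"
    unfolding M_def N_def by (rule scarpis_matrix_carrier[OF Gc])
  ultimately have "hadamard_matrix N M"
    by (simp add: hadamard_matrix_iff)
  then show ?thesis
    by (simp add: M_def N_def)
qed

section \<open>From a labelled tensor set to labelled Latin squares\<close>

theorem corollary2:
  fixes n :: nat
    and G H :: "int mat"
    and \<X> :: "tensor set"
    and X :: "nat \<Rightarrow> tensor"
  assumes "n \<ge> 2"
    and "(G, H) \<in> normalized_hadamard n \<times> normalized_hadamard n"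
    and "complete_tensor_set (n - 1) \<X>"
    and "bij_betw X {1..n - 2} \<X>"
  shows "hadamard_matrix (n * (n - 1)) (scarpis_matrix n X G H)"
proof -
  define k where "k = n - 1"
  \<comment> \<open>The labels of the \<open>n - 2\<close> tensors are the numbers of the block rows
    after block row 0.\<close>
  have n: "n = Suc k" and range: "{1..n - 2} = {1..<k}"
    using assms(1) by (auto simp: k_def)
  obtain S where S: "complete_LSESC k S" and \<X>: "\<X> = latin_tensor k ` S"
    using assms(3) by (auto simp: complete_tensor_set_def k_def)
  have "X ` {1..<k} = latin_tensor k ` S" and inj: "inj_on X {1..<k}"
    using assms(4) unfolding bij_betw_def range \<X> by simp_all
  \<comment> \<open>\<open>X\<close> labels tensors; behind each of them a Latin square from
    \<open>S\<close> is chosen.\<close>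
  then have "\<forall>s\<in>{1..<k}. \<exists>A\<in>S. X s = latin_tensor k A"
    by blast
  then obtain L where L: "\<And>s. s \<in> {1..<k} \<Longrightarrow> L s \<in> S \<and> X s = latin_tensor k (L s)"
    by metis
  \<comment> \<open>Completeness gives LSESC only for distinct members of \<open>S\<close>; equal
    squares would give equal tensors, against injectivity of \<open>X\<close>.\<close>
  have "L s \<noteq> L s'" if "s \<in> {1..<k}" "s' \<in> {1..<k}" "s \<noteq> s'" for s s'
    using inj_onD[OF inj, of s s'] L[OF that(1)] L[OF that(2)] that by auto
  then have "hadamard_matrix (Suc k * k) (scarpis_matrix (Suc k) X G H)"
    using assms(2) S L by (intro hadamard_scarpis_matrix[of G k H L X])
      (auto simp: n complete_LSESC_def)
  then show ?thesis
    by (simp add: n)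
qed

end
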